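(* Every cave $\mathscr{C}\subset\mathbb{N}^p$ is a generalized polymatroid.
   Context: For $\mathbf{a}\in\mathbb{N}^p$ let $|\mathbf{a}|$ be the coordinate sum and $[p]=\{1,\ldots,p\}$; $\le$ on $\mathbb{N}^p$ is componentwise. A (base) polymatroid is a finite subset $\mathscr{P}\subset\mathbb{N}^q$, all of whose elements have the same coordinate sum, such that for all $\mathbf{u},\mathbf{v}\in\mathscr{P}$ and $i\in[q]$ with $u_i>v_i$ there is $j\in[q]$ with $u_j<v_j$ and $\mathbf{u}-\mathbf{e}_i+\mathbf{e}_j\in\mathscr{P}$. A generalized polymatroid is a finite subset $\mathscr{G}\subset\mathbb{N}^p$ such that $\{(\mathbf{a},M-|\mathbf{a}|)\in\mathbb{N}^{p+1}\mid\mathbf{a}\in\mathscr{G}\}$ is a polymatroid, where $M=\max\{|\mathbf{a}|\mid\mathbf{a}\in\mathscr{G}\}$. For a finite set $\mathscr{A}\subset\mathbb{N}^p$: its top is $\mathscr{A}^{\mathrm{top}}=\{\mathbf{a}\in\mathscr{A}\mid|\mathbf{a}|=\max_{\mathbf{a}'\in\mathscr{A}}|\mathbf{a}'|\}$, and for $\mathbf{b}\in\mathbb{N}^p$ its $\mathbf{b}$-truncation is $\mathscr{A}_{\mathbf{b}}=\{\mathbf{a}\in\mathscr{A}\mid\mathbf{a}\ge\mathbf{b}\}$. Stalactites: for a polymatroid $\mathscr{P}\subset\mathbb{N}^p$, $\mathbf{u}\in\mathscr{P}$ and $\mathscr{V}\subset\mathscr{P}$ with $\mathbf{u}\notin\mathscr{V}$,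 let $\mathfrak{I}$ be the set of all $\ell\in[p]$ such that $\mathbf{u}-\mathbf{e}_\ell+\mathbf{e}_j\in\mathscr{V}$ for some $j\in[p]$; then $\mathrm{St}(\mathbf{u};\mathscr{V})=\{\mathbf{u}-\sum_{\ell\in L}\mathbf{e}_\ell\mid L\subseteq\mathfrak{I}\}$. A finite set $\mathscr{C}\subset\mathbb{N}^p$ is a cave if for every $\mathbf{b}\in\mathbb{N}^p$ the truncation $\mathscr{A}:=\mathscr{C}_{\mathbf{b}}$ satisfies (conditions being vacuous when $\mathscr{A}=\emptyset$): (a) $\mathscr{A}^{\mathrm{top}}$ is a polymatroid. (b) For every total order on $[p]$, letting $\prec$ be the induced lexicographic order on $\mathbb{N}^p$ ($\mathbf{a}\prec\mathbf{a}'$ if $\mathbf{a}$ has the smaller entry at the first index, in the chosen order of $[p]$, where they differ) and sorting $\mathscr{A}^{\mathrm{top}}$ as $\mathbf{a}_1\prec\mathbf{a}_2\prec\cdots\prec\mathbf{a}_s$ with $s=|\mathscr{A}^{\mathrm{top}}|$, one has $\mathscr{A}=\bigcup_{i=1}^{s}\mathrm{St}(\mathbf{a}_i;\{\mathbf{a}_1,\ldots,\mathbf{a}_{i-1}\})$. (c) If $\mathbf{b}\ne\mathbf{0}$, then $\mathscr{A}$ is a generalized polymatroid. *)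

theory Defs
  imports "HOL-Library.Function_Algebras"
begin

text \<open>
  A vector in \<open>\<nat>\<^sup>p\<close> is a function \<open>nat \<Rightarrow> nat\<close> vanishing outside the index set \<open>[p] = {1..p}\<close>.
  The operations \<open>+\<close>, \<open>-\<close>, \<open>0\<close> and the order \<open>\<le>\<close> on vectors are the pointwise ones on functions.
\<close>

definition vectors :: "nat \<Rightarrow> (nat \<Rightarrow> nat) set" where
  "vectors p = {a. \<forall>i. i \<notin> {1..p} \<longrightarrow> a i = 0}"

definition coord_sum :: "nat \<Rightarrow> (nat \<Rightarrow> nat) \<Rightarrow> nat" where
  "coord_sum p a = (\<Sum>i\<in>{1..p}. a i)"

definition unit_vec :: "nat \<Rightarrow> nat \<Rightarrow> nat" where
  "unit_vec i = (\<lambda>k. if k = i then 1 else 0)"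

text \<open>
  In the exchange condition \<open>u i > v i \<ge> 0\<close>, so the subtraction on \<open>nat\<close> does not truncate.
\<close>

definition polymatroid :: "nat \<Rightarrow> (nat \<Rightarrow> nat) set \<Rightarrow> bool" where
  "polymatroid q P \<longleftrightarrow>
     finite P \<and> P \<subseteq> vectors q \<and>
     (\<forall>u\<in>P. \<forall>v\<in>P. coord_sum q u = coord_sum q v) \<and>
     (\<forall>u\<in>P. \<forall>v\<in>P. \<forall>i\<in>{1..q}. u i > v i \<longrightarrow>
        (\<exists>j\<in>{1..q}. u j < v j \<and> u - unit_vec i + unit_vec j \<in> P))"

text \<open>
  For \<open>a\<close> in \<open>\<nat>\<^sup>p\<close>, the function update \<open>a(p + 1 := m)\<close> is the vector \<open>(a, m)\<close> in \<open>\<nat>\<^sup>p\<^sup>+\<^sup>1\<close>.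
  The unspecified value of \<open>Max {}\<close> is irrelevant: for \<open>G = {}\<close> the extended set is empty,
  so the empty set is a generalized polymatroid.
\<close>

definition generalized_polymatroid :: "nat \<Rightarrow> (nat \<Rightarrow> nat) set \<Rightarrow> bool" where
  "generalized_polymatroid p G \<longleftrightarrow>
     finite G \<and> G \<subseteq> vectors p \<and>
     (let M = Max (coord_sum p ` G)
      in polymatroid (p + 1) {a(p + 1 := M - coord_sum p a) | a. a \<in> G})"

definition top_part :: "nat \<Rightarrow> (nat \<Rightarrow> nat) set \<Rightarrow> (nat \<Rightarrow> nat) set" where
  "top_part p A = {a \<in> A. coord_sum p a = Max (coord_sum p ` A)}"

definition truncation :: "(nat \<Rightarrow> nat) set \<Rightarrow> (nat \<Rightarrow> nat) \<Rightarrow> (nat \<Rightarrow> nat) set" where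
  "truncation A b = {a \<in> A. b \<le> a}"

text \<open>
  The condition \<open>u l > 0\<close> ensures that \<open>u - unit_vec l\<close> is the true difference in \<open>\<int>\<^sup>p\<close>.
  It excludes no index of the intended set: for \<open>u l = 0\<close> the vector \<open>u - e\<^sub>l + e\<^sub>j\<close> computed in
  \<open>\<int>\<^sup>p\<close> has a negative entry if \<open>j \<noteq> l\<close>, and equals \<open>u \<notin> V\<close> if \<open>j = l\<close>.
\<close>

definition stalactite_directions ::
    "nat \<Rightarrow> (nat \<Rightarrow> nat) \<Rightarrow> (nat \<Rightarrow> nat) set \<Rightarrow> nat set" where
  "stalactite_directions p u V =
     {l \<in> {1..p}. u l > 0 \<and> (\<exists>j\<in>{1..p}. u - unit_vec l + unit_vec j \<in> V)}"

definition stalactite :: "nat \<Rightarrow> (nat \<Rightarrow> nat) \<Rightarrow> (nat \<Rightarrow> nat) set \<Rightarrow> (nat \<Rightarrow> nat) set" where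
  "stalactite p u V = {u - (\<Sum>l\<in>L. unit_vec l) | L. L \<subseteq> stalactite_directions p u V}"

text \<open>
  A total order on \<open>[p]\<close> is a relation \<open>r\<close> with \<open>linear_order_on {1..p} r\<close>, where
  \<open>(i, k) \<in> r\<close> means that \<open>i\<close> comes before or equals \<open>k\<close>.
\<close>

definition lex_less :: "nat \<Rightarrow> nat rel \<Rightarrow> (nat \<Rightarrow> nat) \<Rightarrow> (nat \<Rightarrow> nat) \<Rightarrow> bool" where
  "lex_less p r a a' \<longleftrightarrow>
     (\<exists>k\<in>{1..p}. a k < a' k \<and> (\<forall>i\<in>{1..p}. (i, k) \<in> r \<and> i \<noteq> k \<longrightarrow> a i = a' i))"

text \<open>
  If \<open>T\<close> is sorted as \<open>a\<^sub>1, \<dots>, a\<^sub>s\<close>, then the predecessors of \<open>u = a\<^sub>i\<close> in \<open>T\<close> are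
  \<open>a\<^sub>1, \<dots>, a\<^sub>i\<^sub>-\<^sub>1\<close>; the lemma \<open>stalactite_union_sorted\<close> below confirms that the union is
  the one taken along the sorted list.
\<close>

definition stalactite_union :: "nat \<Rightarrow> nat rel \<Rightarrow> (nat \<Rightarrow> nat) set \<Rightarrow> (nat \<Rightarrow> nat) set" where
  "stalactite_union p r T = (\<Union>u\<in>T. stalactite p u {v \<in> T. lex_less p r v u})"

definition cave :: "nat \<Rightarrow> (nat \<Rightarrow> nat) set \<Rightarrow> bool" where
  "cave p C \<longleftrightarrow>
     finite C \<and> C \<subseteq> vectors p \<and>
     (\<forall>b\<in>vectors p. let A = truncation C b in
        A \<noteq> {} \<longrightarrow>
          polymatroid p (top_part p A) \<and>
          (\<forall>r. linear_order_on {1..p} r \<longrightarrow> A = stalactite_union p r (top_part p A)) \<and>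
          (b \<noteq> 0 \<longrightarrow> generalized_polymatroid p A))"

lemma lex_less_asym:
  assumes r: "linear_order_on {1..p} r" and "lex_less p r a b"
  shows "\<not> lex_less p r b a"
proof
  assume "lex_less p r b a"
  then obtain k where k: "k \<in> {1..p}" "b k < a k"
      "\<forall>i\<in>{1..p}. (i, k) \<in> r \<and> i \<noteq> k \<longrightarrow> b i = a i"
    unfolding lex_less_def by blast
  from assms(2) obtain l where l: "l \<in> {1..p}" "a l < b l"
      "\<forall>i\<in>{1..p}. (i, l) \<in> r \<and> i \<noteq> l \<longrightarrow> a i = b i"
    unfolding lex_less_def by blast
  have "k \<noteq> l" using k(2) l(2) by auto
  then have "(k, l) \<in> r \<or> (l, k) \<in> r"
    using r k(1) l(1) unfolding linear_order_on_def total_on_def by blast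
  then show False using k l \<open>k \<noteq> l\<close> by force
qed

lemma stalactite_union_sorted:
  assumes r: "linear_order_on {1..p} r"
    and sorted: "sorted_wrt (lex_less p r) as" and T: "set as = T"
  shows "stalactite_union p r T = (\<Union>i<length as. stalactite p (as ! i) (set (take i as)))"
proof -
  have "{v \<in> T. lex_less p r v (as ! i)} = set (take i as)" if i: "i < length as" for i
  proof -
    have less_iff: "lex_less p r (as ! j) (as ! i) \<longleftrightarrow> j < i" if j: "j < length as" for j
    proof
      assume less: "lex_less p r (as ! j) (as ! i)"
      then have not_greater: "\<not> lex_less p r (as ! i) (as ! j)"
        by (rule lex_less_asym[OF r])
      show "j < i"
      proof (rule ccontr)
        assume "\<not> j < i"
        then consider "j = i" | "i < j" by linarith
        then show False
        proof cases
          case 1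
          then show False using less not_greater by simp
        next
          case 2
          then show False using sorted_wrt_nth_less[OF sorted 2 j] not_greater by simp
        qed
      qed
    next
      assume "j < i"
      then show "lex_less p r (as ! j) (as ! i)"
        using sorted_wrt_nth_less[OF sorted _ i] by simp
    qed
    show ?thesis
    proof (intro subset_antisym subsetI)
      fix v
      assume "v \<in> {v \<in> T. lex_less p r v (as ! i)}"
      then have v: "v \<in> set as" "lex_less p r v (as ! i)"
        using T by simp_all
      from v(1) obtain j where j: "j < length as" "as ! j = v"
        unfolding in_set_conv_nth by (elim exE conjE)
      then have "j < i"
        using v(2) less_iff[OF j(1)] by simp
      then have "take i as ! j \<in> set (take i as)"
        using i by (intro nth_mem) simp
      then show "v \<in> set (take i as)"
        using \<open>j < i\<close> j(2) by simp
    next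
      fix v
      assume "v \<in> set (take i as)"
      then obtain j where j: "j < length (take i as)" "take i as ! j = v"
        unfolding in_set_conv_nth by (elim exE conjE)
      then have "j < i" "as ! j = v" "j < length as"
        by simp_all
      then show "v \<in> {v \<in> T. lex_less p r v (as ! i)}"
        using less_iff[of j] nth_mem[of j as] T by simp
    qed
  qed
  moreover have "T = (!) as ` {0..<length as}"
    using nth_image[of "length as" as] T by simp
  ultimately show ?thesis
    unfolding stalactite_union_def by (simp add: atLeast0LessThan)
qed

end

theory Submission
  imports Defs
begin

text \<open>
  Let \<open>T\<close> be the top of the cave and \<open>g S\<close> the minimum of \<open>t(S) = \<Sum>\<^sub>i\<^sub>\<in>\<^sub>S t\<^sub>i\<close> over \<open>t \<in> T\<close>.  The cave
  consists exactly of the vectors \<open>x\<close> below some element of \<open>T\<close> with \<open>x(S) \<ge> g S - |S| + 1\<close> for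
  every nonempty \<open>S\<close>.  Necessity: in an order that puts an element \<open>n\<close> of \<open>S\<close> last, \<open>n\<close> is never a
  stalactite direction, so fewer than \<open>|S|\<close> units are removed inside \<open>S\<close>.  Sufficiency: among the
  \<open>t \<in> T\<close> with \<open>x \<le> t \<le> x + 1\<close> take one with \<open>\<Sum>\<^sub>k k t\<^sub>k\<close> minimal.
  Since \<open>g\<close> is supermodular, \<open>g S - |S| + 1\<close> is supermodular on intersecting pairs, and uncrossing
  tight sets yields the exchange property.
\<close>

section \<open>Unit moves and their effect on coordinate sums\<close>

definition move :: "nat \<Rightarrow> nat \<Rightarrow> (nat \<Rightarrow> nat) \<Rightarrow> nat \<Rightarrow> nat" where
  "move i j u = u - unit_vec i + unit_vec j"

lemma move_apply: "move i j u k = u k - of_bool (k = i) + of_bool (k = j)"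
  by (simp add: move_def unit_vec_def)

lemma sum_unit_vec: "finite S \<Longrightarrow> (\<Sum>k\<in>S. unit_vec i k) = of_bool (i \<in> S)"
  by (simp add: unit_vec_def)

lemma sum_diff_unit_vec:
  assumes "finite S" "u i > 0"
  shows "sum (u - unit_vec i) S + of_bool (i \<in> S) = sum u S"
proof -
  have "sum u S = (\<Sum>k\<in>S. (u - unit_vec i) k + unit_vec i k)"
    using assms(2) by (intro sum.cong) (auto simp: unit_vec_def)
  then show ?thesis
    by (simp only: sum.distrib sum_unit_vec[OF assms(1)])
qed

lemma sum_move:
  assumes "finite S" "u i > 0"
  shows "sum (move i j u) S + of_bool (i \<in> S) = sum u S + of_bool (j \<in> S)"
proof -
  have "sum (move i j u) S = sum (u - unit_vec i) S + of_bool (j \<in> S)"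
    unfolding move_def plus_fun_def sum.distrib sum_unit_vec[OF assms(1)] by (simp only:)
  then show ?thesis
    using sum_diff_unit_vec[where u = u and i = i, OF assms] by simp
qed

text \<open>A one-sided distance: natural subtraction counts only the coordinates where
  \<open>t\<close> lies above \<open>s\<close>. It is the measure decreased by the induction and the
  extremal choices that follow.\<close>

definition excess :: "nat \<Rightarrow> (nat \<Rightarrow> nat) \<Rightarrow> (nat \<Rightarrow> nat) \<Rightarrow> nat" where
  "excess p t s = (\<Sum>k\<in>{1..p}. t k - s k)"

lemma excess_move_left:
  assumes "a \<in> {1..p}" "t a > s a" "t b < s b"
  shows "excess p (move a b t) s < excess p t s"
  unfolding excess_def
proof (rule sum_strict_mono_ex1)
  show "\<forall>k\<in>{1..p}. move a b t k - s k \<le> t k - s k"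
    using assms by (auto simp: move_apply)
  show "\<exists>k\<in>{1..p}. move a b t k - s k < t k - s k"
    using assms by (intro bexI[of _ a]) (auto simp: move_apply)
qed simp

lemma excess_move_right:
  assumes "c \<in> {1..p}" "s b > t b" "s c < t c"
  shows "excess p t (move b c s) < excess p t s"
  unfolding excess_def
proof (rule sum_strict_mono_ex1)
  show "\<forall>k\<in>{1..p}. t k - move b c s k \<le> t k - s k"
    using assms by (auto simp: move_apply)
  show "\<exists>k\<in>{1..p}. t k - move b c s k < t k - s k"
    using assms by (intro bexI[of _ c]) (auto simp: move_apply)
qed simp

section \<open>Exchange in a polymatroid and minimal sums over coordinate sets\<close>

locale nonempty_polymatroid =
  fixes p :: nat and T :: "(nat \<Rightarrow> nat) set"
  assumes polymatroid: "polymatroid p T" and nonempty: "T \<noteq> {}"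
begin

lemma finite_T: "finite T" and T_vectors: "T \<subseteq> vectors p"
  using polymatroid by (auto simp: polymatroid_def)

lemma sum_eq: "u \<in> T \<Longrightarrow> v \<in> T \<Longrightarrow> sum u {1..p} = sum v {1..p}"
  using polymatroid unfolding polymatroid_def coord_sum_def by blast

lemma exchange:
  assumes "u \<in> T" "v \<in> T" "i \<in> {1..p}" "u i > v i"
  obtains j where "j \<in> {1..p}" "u j < v j" "move i j u \<in> T"
  using polymatroid assms unfolding polymatroid_def move_def by blast

text \<open>Natural subtraction can hide a missing unit: if \<open>u i = 0\<close>, the move merely
  adds one at \<open>j\<close> and changes the coordinate sum, which is constant on
  \<open>T\<close>.\<close>

lemma move_pos:
  assumes "u \<in> T" "move i j u \<in> T" "j \<in> {1..p}" "i \<noteq> j"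
  shows "u i > 0"
proof (rule ccontr)
  assume "\<not> u i > 0"
  then have "move i j u = (\<lambda>k. u k + unit_vec j k)"
    by (auto simp: fun_eq_iff move_apply unit_vec_def)
  then have "sum (move i j u) {1..p} = sum u {1..p} + 1"
    using assms(3) by (simp add: sum.distrib sum_unit_vec)
  then show False
    using sum_eq[OF assms(1,2)] by simp
qed

text \<open>Exchange \<open>move a b t\<close> against \<open>move l a t\<close> at
  \<open>l\<close>. Only at \<open>a\<close> is the first vector the smaller one, so the exchange
  must return the unit to \<open>a\<close>.\<close>

lemma move_trans:
  assumes "t \<in> T" "move l a t \<in> T" "move a b t \<in> T" "l \<in> {1..p}" "a \<in> {1..p}" "b \<in> {1..p}"
    and "l \<noteq> a" "a \<noteq> b" "l \<noteq> b"
  shows "move l b t \<in> T"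
proof -
  have pos: "t l > 0" "t a > 0"
    using assms move_pos by blast+
  then have "move a b t l > move l a t l"
    using assms by (simp add: move_apply)
  then obtain m where m: "move a b t m < move l a t m" "move l m (move a b t) \<in> T"
    using exchange assms by blast
  have "m = a"
    using m(1) assms(7-) by (cases "m = a"; cases "m = b"; cases "m = l") (auto simp: move_apply)
  moreover have "move l a (move a b t) = move l b t"
    using pos assms(7-) by (auto simp: fun_eq_iff move_apply)
  ultimately show ?thesis
    using m(2) by simp
qed

text \<open>If \<open>s\<close> had the smaller sum on \<open>N\<close>, exchanging \<open>t\<close>
  towards \<open>s\<close> at some \<open>a\<close> in \<open>N\<close> would give a
  \<open>b\<close> that closedness keeps in \<open>N\<close>. Exchanging \<open>s\<close> back
  towards \<open>t\<close> at this \<open>b\<close> comes closer to \<open>t\<close> without raising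
  the sum on \<open>N\<close>, so the induction hypothesis applies.\<close>

lemma local_min_is_min:
  assumes "t \<in> T" "N \<subseteq> {1..p}"
    and closed: "\<And>a b. a \<in> N \<Longrightarrow> b \<in> {1..p} - N \<Longrightarrow> move a b t \<notin> T"
    and "s \<in> T"
  shows "sum t N \<le> sum s N"
  using \<open>s \<in> T\<close>
proof (induction "excess p t s" arbitrary: s rule: less_induct)
  case less
  have fin: "finite N"
    using assms(2) finite_subset by blast
  show ?case
  proof (rule ccontr)
    assume "\<not> ?thesis"
    then have lt: "sum s N < sum t N" by simp
    then obtain a where a: "a \<in> N" "t a > s a"
      by (meson not_le sum_mono)
    then obtain b where b: "b \<in> {1..p}" "t b < s b" "move a b t \<in> T"
      using exchange[OF \<open>t \<in> T\<close> \<open>s \<in> T\<close>] assms(2) by blast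
    then have "b \<in> N"
      using closed a by blast
    obtain c where c: "c \<in> {1..p}" "s c < t c" "move b c s \<in> T"
      using exchange[OF \<open>s \<in> T\<close> \<open>t \<in> T\<close> b(1,2)] by blast
    have "sum t N \<le> sum (move b c s) N"
      using less.hyps[OF excess_move_right c(3)] b c by blast
    then show False
      using sum_move[OF fin, of s b c] b(2) \<open>b \<in> N\<close> lt by (simp add: of_bool_def split: if_splits)
  qed
qed

definition min_sum :: "nat set \<Rightarrow> nat" where
  "min_sum S = Min ((\<lambda>t. sum t S) ` T)"

lemma min_sum_le: "t \<in> T \<Longrightarrow> min_sum S \<le> sum t S"
  unfolding min_sum_def using finite_T by simp

lemma min_sum_attained:
  obtains t where "t \<in> T" "sum t S = min_sum S"
proof -
  have "min_sum S \<in> (\<lambda>t. sum t S) ` T"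
    unfolding min_sum_def using finite_T nonempty by (intro Min_in) auto
  then show thesis
    using that by auto
qed

lemma local_min_sum:
  assumes "t \<in> T" "N \<subseteq> {1..p}"
    and "\<And>a b. a \<in> N \<Longrightarrow> b \<in> {1..p} - N \<Longrightarrow> move a b t \<notin> T"
  shows "sum t N = min_sum N"
  using local_min_is_min[OF assms] min_sum_attained[of N] min_sum_le[OF assms(1), of N]
  by (metis le_antisym)

text \<open>One element of \<open>T\<close> attains the minimum on both \<open>A \<inter> B\<close> and \<open>A \<union> B\<close>.\<close>

lemma min_sum_supermodular:
  assumes "A \<subseteq> {1..p}" "B \<subseteq> {1..p}"
  shows "min_sum A + min_sum B \<le> min_sum (A \<union> B) + min_sum (A \<inter> B)"
proof -
  have fin: "finite A" "finite B"
    using assms finite_subset by blast+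
  let ?P = "\<lambda>t. t \<in> T \<and> sum t (A \<inter> B) = min_sum (A \<inter> B)"
  obtain t0 where "?P t0"
    using min_sum_attained by blast
  then obtain t where t: "?P t" and least: "\<And>s. ?P s \<Longrightarrow> sum t (A \<union> B) \<le> sum s (A \<union> B)"
    using ex_has_least_nat[of ?P t0 "\<lambda>t. sum t (A \<union> B)"] by blast
  have "sum t (A \<union> B) = min_sum (A \<union> B)"
  proof (rule local_min_sum)
    show "t \<in> T" "A \<union> B \<subseteq> {1..p}"
      using t assms by auto
    fix a b
    assume ab: "a \<in> A \<union> B" "b \<in> {1..p} - (A \<union> B)"
    show "move a b t \<notin> T"
    proof
      assume T: "move a b t \<in> T"
      have pos: "t a > 0"
        using move_pos[OF _ T] t ab by auto
      \<comment> \<open>As \<open>b\<close> lies outside \<open>A \<union> B\<close>, the move keeps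
        the minimum on \<open>A \<inter> B\<close> while lowering the sum on
        \<open>A \<union> B\<close>, against the choice of \<open>t\<close>.\<close>
      have "sum (move a b t) (A \<inter> B) \<le> sum t (A \<inter> B)"
        using sum_move[of "A \<inter> B" t a b] pos fin ab by auto
      then have "sum t (A \<union> B) \<le> sum (move a b t) (A \<union> B)"
        using least T t min_sum_le[OF T, of "A \<inter> B"] by simp
      then show False
        using sum_move[of "A \<union> B" t a b] pos fin ab by auto
    qed
  qed
  moreover have "sum t A + sum t B = sum t (A \<union> B) + sum t (A \<inter> B)"
    using sum.union_inter[OF fin, of t] by simp
  ultimately show ?thesis
    using t min_sum_le[of t A] min_sum_le[of t B] by simp
qed

text \<open>\<open>N\<close> is the analogue of a fundamental cocircuit: the coordinates that can
  take over a unit from \<open>l\<close>. By \<open>move_trans\<close>, a move leaving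
  \<open>N\<close> would compose to a move from \<open>l\<close> to outside
  \<open>N\<close>.\<close>

lemma fundamental_set_tight:
  assumes "t \<in> T" "l \<in> {1..p}"
  defines "N \<equiv> {n \<in> {1..p}. n = l \<or> move l n t \<in> T}"
  shows "sum t N = min_sum N"
proof (rule local_min_sum)
  fix a b
  assume "a \<in> N" "b \<in> {1..p} - N"
  then show "move a b t \<notin> T"
    using move_trans[of t l a b] assms unfolding N_def by auto
qed (use assms in auto)

text \<open>Dually, \<open>X\<close> is the analogue of a fundamental circuit: the coordinates that
  can pass a unit to \<open>j\<close>. By \<open>move_trans\<close>, no move enters \<open>X\<close>
  from its complement.\<close>

lemma cofundamental_set_tight:
  assumes "t \<in> T" "j \<in> {1..p}"
  defines "X \<equiv> {k \<in> {1..p}. k = j \<or> move k j t \<in> T}"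
  shows "sum t ({1..p} - X) = min_sum ({1..p} - X)"
proof (rule local_min_sum)
  fix a b
  assume "a \<in> {1..p} - X" "b \<in> {1..p} - ({1..p} - X)"
  then show "move a b t \<notin> T"
    using move_trans[of t a b j] assms unfolding X_def by auto
qed (use assms in auto)

section \<open>The down-closure of \<open>T\<close> and the region cut out by the lower
  bounds\<close>

definition independent :: "(nat \<Rightarrow> nat) \<Rightarrow> bool" where
  "independent x \<longleftrightarrow> (\<exists>t\<in>T. x \<le> t)"

lemma independent_mono: "independent y \<Longrightarrow> x \<le> y \<Longrightarrow> independent x"
  unfolding independent_def using order_trans by blast

text \<open>Choose \<open>t\<close> above \<open>x\<close> nearest to an \<open>s\<close> above
  \<open>y\<close>. Where the slack of \<open>t\<close> over \<open>x\<close> exceeds that of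
  \<open>s\<close> over \<open>y\<close>, nearness gives \<open>t k \<le> s k\<close>, hence
  \<open>x k < y k\<close>, and \<open>t\<close> still has room for the extra unit.\<close>

lemma independent_augment:
  assumes "independent x" "independent y" "sum x {1..p} < sum y {1..p}"
  obtains j where "j \<in> {1..p}" "x j < y j" "independent (x + unit_vec j)"
proof -
  obtain t0 s where t0: "t0 \<in> T \<and> x \<le> t0" and s: "s \<in> T" "y \<le> s"
    using assms unfolding independent_def by blast
  obtain t where t: "t \<in> T" "x \<le> t"
    and least: "\<And>t'. t' \<in> T \<Longrightarrow> x \<le> t' \<Longrightarrow> excess p t s \<le> excess p t' s"
    using ex_has_least_nat[of "\<lambda>t. t \<in> T \<and> x \<le> t" t0 "\<lambda>t. excess p t s"] t0 by blast
  have "\<exists>k\<in>{1..p}. t k + y k > s k + x k"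
  proof (rule ccontr)
    assume "\<not> ?thesis"
    then have "(\<Sum>k\<in>{1..p}. t k + y k) \<le> (\<Sum>k\<in>{1..p}. s k + x k)"
      by (intro sum_mono) (simp add: not_less)
    then show False
      using assms(3) sum_eq[OF t(1) s(1)] by (simp add: sum.distrib)
  qed
  then obtain k where k: "k \<in> {1..p}" "t k + y k > s k + x k" by blast
  have "y k \<le> s k"
    using s(2) by (simp add: le_fun_def)
  then have tx: "t k > x k"
    using k by simp
  have "t k \<le> s k"
  proof (rule ccontr)
    assume "\<not> ?thesis"
    then obtain m where m: "m \<in> {1..p}" "t m < s m" "move k m t \<in> T"
      using exchange[OF t(1) s(1) k(1)] by auto
    have "x \<le> move k m t"
      using t(2) tx by (auto simp: le_fun_def move_apply le_diff_conv trans_le_add1)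
    then have "excess p t s \<le> excess p (move k m t) s"
      using least m by blast
    then show False
      using excess_move_left[of k p s t m] k(1) m \<open>\<not> t k \<le> s k\<close> by simp
  qed
  then have "x k < y k"
    using k by simp
  moreover have "x + unit_vec k \<le> t"
    using t(2) tx by (auto simp: le_fun_def unit_vec_def)
  ultimately show thesis
    using that k(1) t(1) unfolding independent_def by blast
qed

text \<open>The bounds are written additively because natural subtraction would truncate
  \<open>min_sum S - card S + 1\<close>. For \<open>S = {}\<close> the inequality would read
  \<open>1 \<le> 0\<close>.\<close>

definition region :: "(nat \<Rightarrow> nat) set" where
  "region = {x. independent x \<and>
     (\<forall>S\<subseteq>{1..p}. S \<noteq> {} \<longrightarrow> min_sum S + 1 \<le> sum x S + card S)}"

lemma regionD:
  assumes "x \<in> region" "S \<subseteq> {1..p}" "S \<noteq> {}"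
  shows "min_sum S + 1 \<le> sum x S + card S"
  using assms unfolding region_def by blast

lemma region_upward:
  assumes "x \<in> region" "x \<le> y" "independent y"
  shows "y \<in> region"
  unfolding region_def
proof (intro CollectI conjI allI impI)
  fix S :: "nat set"
  assume "S \<subseteq> {1..p}" "S \<noteq> {}"
  then have "min_sum S + 1 \<le> sum x S + card S"
    by (rule regionD[OF assms(1)])
  moreover have "sum x S \<le> sum y S"
    using assms(2) by (intro sum_mono) (simp add: le_fun_def)
  ultimately show "min_sum S + 1 \<le> sum y S + card S"
    by simp
qed fact

lemma region_augment:
  assumes "x \<in> region" "independent y" "sum x {1..p} < sum y {1..p}"
  obtains j where "j \<in> {1..p}" "x j < y j" "x + unit_vec j \<in> region"
proof -
  obtain j where "j \<in> {1..p}" "x j < y j" "independent (x + unit_vec j)"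
    using independent_augment assms unfolding region_def by blast
  moreover have "x \<le> x + unit_vec j"
    by (simp add: le_fun_def)
  ultimately show thesis
    using that region_upward assms(1) by blast
qed

text \<open>Lowering \<open>u i\<close> alone violates a tight bound, so a compensating
  \<open>j\<close> is sought in a tight \<open>S\<close> of least cardinality containing
  \<open>i\<close>. As \<open>v\<close> obeys the bound on \<open>S\<close>, its sum there is at
  least that of \<open>u\<close>, and \<open>u i > v i\<close> forces \<open>u j < v j\<close>
  somewhere in \<open>S\<close>.\<close>

lemma region_exchange_tight:
  assumes u: "u \<in> region" and v: "v \<in> region" and i: "i \<in> {1..p}" "u i > v i"
    and tight: "\<exists>S\<subseteq>{1..p}. i \<in> S \<and> sum u S + card S = min_sum S + 1"
  obtains j where "j \<in> {1..p}" "u j < v j" "move i j u \<in> region"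
proof -
  let ?tight = "\<lambda>S. S \<subseteq> {1..p} \<and> i \<in> S \<and> sum u S + card S = min_sum S + 1"
  obtain S where S: "?tight S" and least: "\<And>R. ?tight R \<Longrightarrow> card S \<le> card R"
    using ex_has_least_nat[of ?tight _ card] tight by metis
  have fin: "finite R" if "R \<subseteq> {1..p}" for R
    using that finite_subset by blast
  have "S \<noteq> {}"
    using S by blast
  then have "sum u S \<le> sum v S"
    using regionD[OF v, of S] S by simp
  then have "\<not> (\<forall>k\<in>S. v k \<le> u k)"
    using sum_strict_mono_ex1[of S v u] S i(2) fin by fastforce
  then obtain j where j: "j \<in> S" "u j < v j"
    by (auto simp: not_le)
  have jp: "j \<in> {1..p}" and ij: "i \<noteq> j"
    using j S i by auto
  obtain t where t: "t \<in> T" "u \<le> t"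
    using u unfolding region_def independent_def by blast
  \<comment> \<open>Either \<open>t\<close> has room at \<open>j\<close>, or some coordinate with
    slack can pass a unit of \<open>t\<close> to \<open>j\<close>, or \<open>i\<close> itself can;
    in each case an element of \<open>T\<close> dominates the moved vector.\<close>
  have "independent (move i j u)"
  proof (cases "u j < t j")
    case True
    then have "move i j u \<le> t"
      using t(2) by (auto simp: le_fun_def move_apply le_diff_conv trans_le_add1)
    then show ?thesis
      using t unfolding independent_def by blast
  next
    case False
    define X where "X = {k \<in> {1..p}. k = j \<or> move k j t \<in> T}"
    have X: "X \<subseteq> {1..p}" "j \<in> X"
      using jp by (auto simp: X_def)
    show ?thesis
    proof (cases "\<exists>k\<in>X. u k < t k")
      case True
      then obtain k where k: "k \<in> X" "u k < t k" by blast
      then have "k \<noteq> j" "move k j t \<in> T"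
        using False by (auto simp: X_def)
      moreover have "move i j u \<le> move k j t"
        using t(2) k(2) by (auto simp: le_fun_def move_apply le_diff_conv trans_le_add1)
      ultimately show ?thesis
        unfolding independent_def by blast
    next
      case no_slack: False
      have "i \<in> X"
      proof (rule ccontr)
        assume "i \<notin> X"
        let ?Y = "{1..p} - X"
        have uX: "sum u X = sum t X"
          using no_slack t(2) by (intro sum.cong) (auto simp: le_fun_def le_less)
        have split: "sum t R + sum t ({1..p} - R) = sum t {1..p}" if "R \<subseteq> {1..p}" for R
          using sum.subset_diff[OF that, of t] by simp
        \<comment> \<open>Tightness of \<open>?Y\<close> for \<open>t\<close> and
          \<open>u = t\<close> on \<open>X\<close> turn supermodularity into
          \<open>min_sum S + 1 \<le> sum u S + card (S \<inter> ?Y)\<close>. Since \<open>j\<close>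
          is in \<open>S\<close> but not in \<open>?Y\<close>, this contradicts tightness of
          \<open>S\<close>.\<close>
        have "min_sum S + min_sum ?Y \<le> min_sum (S \<union> ?Y) + min_sum (S \<inter> ?Y)"
          using S by (intro min_sum_supermodular) auto
        moreover have "min_sum ?Y = sum t ?Y"
          using cofundamental_set_tight[OF t(1) jp] unfolding X_def by simp
        moreover have "min_sum (S \<union> ?Y) \<le> sum t (S \<union> ?Y)"
          using min_sum_le t by blast
        moreover have "S \<union> ?Y = {1..p} - (X - S)"
          using S X by auto
        moreover have "sum t X = sum u (X - S) + sum u (S \<inter> X)"
          using uX fin[OF X(1)] sum.Int_Diff[of X u S] by (simp add: Int_commute)
        moreover have "sum u (X - S) \<le> sum t (X - S)"
          using t(2) by (intro sum_mono) (simp add: le_fun_def)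
        moreover have "sum u S = sum u (S \<inter> X) + sum u (S \<inter> ?Y)"
        proof -
          have "S \<inter> ?Y = S - X"
            using S by auto
          then show ?thesis
            using S fin sum.Int_Diff[of S u X] by simp
        qed
        moreover have "card (S \<inter> ?Y) < card S"
          using S j(1) X(2) fin by (intro psubset_card_mono) auto
        moreover have "min_sum (S \<inter> ?Y) + 1 \<le> sum u (S \<inter> ?Y) + card (S \<inter> ?Y)"
          using S i \<open>i \<notin> X\<close> by (intro regionD[OF u]) auto
        moreover have "sum t (X - S) + sum t ({1..p} - (X - S)) = sum t {1..p}"
          using X by (intro split) auto
        ultimately show False
          using split[OF X(1)] S by simp
      qed
      then have "move i j t \<in> T"
        using ij by (simp add: X_def)
      moreover have "move i j u \<le> move i j t"
        using t(2) by (auto simp: le_fun_def move_apply intro!: diff_le_mono)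
      ultimately show ?thesis
        unfolding independent_def by blast
    qed
  qed
  \<comment> \<open>A bound broken by the move belongs to a tight \<open>R\<close> with
    \<open>i\<close> inside and \<open>j\<close> outside. Uncrossing makes
    \<open>S \<inter> R\<close> tight; it contains \<open>i\<close> and lacks \<open>j\<close>,
    contradicting the minimality of \<open>S\<close>.\<close>
  moreover have "min_sum R + 1 \<le> sum (move i j u) R + card R" if R: "R \<subseteq> {1..p}" "R \<noteq> {}" for R
  proof (rule ccontr)
    assume "\<not> ?thesis"
    then have "i \<in> R" "j \<notin> R" and Rt: "sum u R + card R = min_sum R + 1"
      using regionD[OF u R] sum_move[OF fin[OF R(1)], of u i j] i
      by (auto simp: of_bool_def split: if_splits)
    have "min_sum S + min_sum R \<le> min_sum (S \<union> R) + min_sum (S \<inter> R)"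
      using S R by (intro min_sum_supermodular) auto
    moreover have "min_sum (S \<union> R) + 1 \<le> sum u (S \<union> R) + card (S \<union> R)"
      using S R by (intro regionD[OF u]) auto
    moreover have "min_sum (S \<inter> R) + 1 \<le> sum u (S \<inter> R) + card (S \<inter> R)"
      using S \<open>i \<in> R\<close> by (intro regionD[OF u]) auto
    moreover have "sum u (S \<union> R) + sum u (S \<inter> R) = sum u S + sum u R"
      using S R fin by (intro sum.union_inter) auto
    moreover have "card (S \<union> R) + card (S \<inter> R) = card S + card R"
      using S R fin card_Un_Int by metis
    ultimately have "sum u (S \<inter> R) + card (S \<inter> R) = min_sum (S \<inter> R) + 1"
      using S Rt by linarith
    then have "card S \<le> card (S \<inter> R)"
      using S \<open>i \<in> R\<close> by (intro least) auto
    moreover have "card (S \<inter> R) < card S"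
      using S fin j(1) \<open>j \<notin> R\<close> by (intro psubset_card_mono) auto
    ultimately show False by simp
  qed
  ultimately have "move i j u \<in> region"
    unfolding region_def by blast
  then show thesis
    using that jp j by blast
qed

text \<open>The second alternative is the exchange with the coordinate added in a generalized
  polymatroid. If \<open>i\<close> is in no tight set, \<open>u\<close> can be lowered at
  \<open>i\<close>; when \<open>u\<close> is not the larger one in sum, augmenting the result
  towards \<open>v\<close> restores the unit.\<close>

lemma region_exchange:
  assumes u: "u \<in> region" and v: "v \<in> region" and i: "i \<in> {1..p}" "u i > v i"
  shows "(\<exists>j\<in>{1..p}. u j < v j \<and> move i j u \<in> region) \<or>
    sum u {1..p} > sum v {1..p} \<and> u - unit_vec i \<in> region"
proof (cases "\<exists>S\<subseteq>{1..p}. i \<in> S \<and> sum u S + card S = min_sum S + 1")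
  case True
  then show ?thesis
    using region_exchange_tight[OF assms] by blast
next
  case False
  have reduced: "u - unit_vec i \<in> region"
    unfolding region_def
  proof (intro CollectI conjI allI impI)
    show "independent (u - unit_vec i)"
      using u independent_mono[of u "u - unit_vec i"] by (auto simp: region_def le_fun_def)
    fix S :: "nat set"
    assume S: "S \<subseteq> {1..p}" "S \<noteq> {}"
    have "sum (u - unit_vec i) S + of_bool (i \<in> S) = sum u S"
      using S i finite_subset by (intro sum_diff_unit_vec) auto
    moreover have "i \<in> S \<Longrightarrow> sum u S + card S \<noteq> min_sum S + 1"
      using False S by blast
    ultimately show "min_sum S + 1 \<le> sum (u - unit_vec i) S + card S"
      using regionD[OF u S] by (cases "i \<in> S") auto
  qed
  have "\<exists>j\<in>{1..p}. u j < v j \<and> move i j u \<in> region"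
    if "\<not> sum u {1..p} > sum v {1..p}"
  proof -
    have "sum (u - unit_vec i) {1..p} < sum v {1..p}"
      using sum_diff_unit_vec[of "{1..p}" u i] i that by simp
    moreover have "independent v"
      using v by (simp add: region_def)
    ultimately obtain j where j: "j \<in> {1..p}" "(u - unit_vec i) j < v j" "move i j u \<in> region"
      using region_augment[OF reduced] unfolding move_def by metis
    \<comment> \<open>Here \<open>j\<close> differs from \<open>i\<close>, because
      \<open>u i - 1\<close> is still at least \<open>v i\<close>.\<close>
    have "u j < v j"
      using j(2) i by (auto simp: unit_vec_def split: if_splits)
    then show ?thesis
      using j by blast
  qed
  with reduced show ?thesis by blast
qed

text \<open>The tight set of \<open>l\<close> has sum \<open>min_sum ?N\<close> under
  \<open>t\<close>, so the strict bound for \<open>x\<close> leaves some \<open>n\<close> in it with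
  \<open>t n < x n + 1\<close>; this is not \<open>l\<close>, where \<open>t\<close> exceeds
  \<open>x\<close>.\<close>

lemma fundamental_set_slack:
  assumes "x \<in> region" "t \<in> T" "l \<in> {1..p}" "t l > x l"
  obtains n where "n \<in> {1..p}" "t n \<le> x n" "move l n t \<in> T"
proof -
  let ?N = "{n \<in> {1..p}. n = l \<or> move l n t \<in> T}"
  have "min_sum ?N + 1 \<le> sum x ?N + card ?N"
    using assms by (intro regionD) auto
  then have "sum t ?N < (\<Sum>n\<in>?N. x n + 1)"
    using fundamental_set_tight[OF assms(2,3)] by (simp only: sum.distrib card_eq_sum)
  then obtain n where "n \<in> ?N" "t n < x n + 1"
    by (meson not_le sum_mono)
  then show thesis
    using that assms(4) by force
qed

text \<open>Minimise the amount by which \<open>t\<close> exceeds \<open>x + 1\<close>. A coordinate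
  above that bound could pass a unit to the \<open>n\<close> of
  \<open>fundamental_set_slack\<close>, which stays within the bound.\<close>

lemma region_near_top:
  assumes "x \<in> region"
  obtains t where "t \<in> T" "x \<le> t" "\<And>k. t k \<le> x k + 1"
proof -
  obtain t0 where t0: "t0 \<in> T \<and> x \<le> t0"
    using assms unfolding region_def independent_def by blast
  let ?x1 = "\<lambda>k. x k + 1"
  obtain t where t: "t \<in> T" "x \<le> t"
    and least: "\<And>s. s \<in> T \<Longrightarrow> x \<le> s \<Longrightarrow> excess p t ?x1 \<le> excess p s ?x1"
    using ex_has_least_nat[of "\<lambda>t. t \<in> T \<and> x \<le> t" t0 "\<lambda>t. excess p t ?x1"] t0 by blast
  have "t k \<le> x k + 1" for k
  proof (rule ccontr)
    assume gt: "\<not> ?thesis"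
    have k: "k \<in> {1..p}"
      using gt t(1) T_vectors unfolding vectors_def by force
    have "t k > x k"
      using gt by simp
    then obtain n where n: "n \<in> {1..p}" "t n \<le> x n" "move k n t \<in> T"
      by (rule fundamental_set_slack[OF assms t(1) k])
    have "x \<le> move k n t"
      using t(2) gt by (auto simp: le_fun_def move_apply le_diff_conv trans_le_add1)
    then have "excess p t ?x1 \<le> excess p (move k n t) ?x1"
      using least n by blast
    moreover have "excess p (move k n t) ?x1 < excess p t ?x1"
      using gt n k by (intro excess_move_left) auto
    ultimately show False by simp
  qed
  then show thesis
    using that t by blast
qed

end

section \<open>Stalactites compared with the region\<close>

lemma sum_unit_vecs_apply:
  "finite L \<Longrightarrow> (\<Sum>l\<in>L. unit_vec l) k = of_bool (k \<in> L)"
  by (induction L rule: finite_induct) (auto simp: unit_vec_def)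

lemma linear_order_last:
  fixes n :: nat and A :: "nat set"
  defines "r \<equiv> {(a, b). a \<in> A \<and> b \<in> A \<and> (b = n \<or> a \<noteq> n \<and> a \<le> b)}"
  shows "linear_order_on A r"
  unfolding r_def linear_order_on_def partial_order_on_def preorder_on_def
    refl_on_def trans_def antisym_def total_on_def
  by auto

text \<open>A move from \<open>n\<close> to another \<open>j\<close> raises \<open>j\<close>, which
  precedes \<open>n\<close>, so the result is lexicographically larger.\<close>

lemma last_not_direction:
  assumes "\<And>a. a \<in> {1..p} \<Longrightarrow> (a, n) \<in> r"
  shows "n \<notin> stalactite_directions p t {v \<in> T. lex_less p r v t}"
proof
  assume "n \<in> stalactite_directions p t {v \<in> T. lex_less p r v t}"
  then obtain j where j: "j \<in> {1..p}" "t n > 0" "lex_less p r (move n j t) t"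
    unfolding stalactite_directions_def move_def by auto
  then obtain k where k: "move n j t k < t k"
      "\<forall>i\<in>{1..p}. (i, k) \<in> r \<and> i \<noteq> k \<longrightarrow> move n j t i = t i"
    unfolding lex_less_def by blast
  have "k = n" "j \<noteq> n"
    using k(1) j(2) by (cases "k = n"; cases "j = n"; simp add: move_apply)+
  then have "move n j t j = t j"
    using k(2) j(1) assms[OF j(1)] by blast
  then show False
    using \<open>j \<noteq> n\<close> by (simp add: move_apply)
qed

context nonempty_polymatroid
begin

lemma stalactite_union_subset_region:
  assumes "\<And>r. linear_order_on {1..p} r \<Longrightarrow> C = stalactite_union p r T"
  shows "C \<subseteq> region"
proof
  fix x
  assume "x \<in> C"
  have rep: "\<exists>t\<in>T. \<exists>L\<subseteq>{1..p}. n \<notin> L \<and> x = t - (\<Sum>l\<in>L. unit_vec l)" for n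
  proof -
    let ?r = "{(a, b). a \<in> {1..p} \<and> b \<in> {1..p} \<and> (b = n \<or> a \<noteq> n \<and> a \<le> b)}"
    have "x \<in> stalactite_union p ?r T"
      using assms[OF linear_order_last, of n] \<open>x \<in> C\<close> by simp
    then obtain t L where tL: "t \<in> T" "x = t - (\<Sum>l\<in>L. unit_vec l)"
        "L \<subseteq> stalactite_directions p t {v \<in> T. lex_less p ?r v t}"
      unfolding stalactite_union_def stalactite_def by blast
    then have "L \<subseteq> {1..p}"
      unfolding stalactite_directions_def by blast
    moreover have "n \<notin> L"
    proof (cases "n \<in> {1..p}")
      case True
      then show ?thesis
        using tL(3) last_not_direction[of p n ?r t T] by auto
    next
      case False
      then show ?thesis
        using calculation by blast
    qed
    ultimately show ?thesis
      using tL by blast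
  qed
  show "x \<in> region"
    unfolding region_def
  proof (intro CollectI conjI allI impI)
    show "independent x"
    proof -
      obtain t L where "t \<in> T" "x = t - (\<Sum>l\<in>L. unit_vec l)"
        using rep by blast
      then show ?thesis
        unfolding independent_def by (intro bexI[of _ t]) (simp_all add: le_fun_def)
    qed
    fix S :: "nat set"
    assume S: "S \<subseteq> {1..p}" "S \<noteq> {}"
    then obtain n where "n \<in> S" by blast
    \<comment> \<open>A representation avoiding an \<open>n\<close> of \<open>S\<close> removes at
      most \<open>card S - 1\<close> units inside \<open>S\<close>; this is the \<open>+ 1\<close>
      in the bound.\<close>
    obtain t L where tL: "t \<in> T" "L \<subseteq> {1..p}" "n \<notin> L" "x = t - (\<Sum>l\<in>L. unit_vec l)"
      using rep by blast
    have fin: "finite L" "finite S"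
      using tL S finite_subset by blast+
    have "sum t S \<le> (\<Sum>k\<in>S. x k + of_bool (k \<in> L))"
      unfolding tL(4) by (intro sum_mono) (simp add: sum_unit_vecs_apply[OF fin(1)])
    also have "\<dots> = sum x S + card (S \<inter> L)"
      using fin by (simp add: sum.distrib of_bool_def sum.If_cases)
    finally have "sum t S \<le> sum x S + card (S \<inter> L)" .
    moreover have "card (S \<inter> L) < card S"
      using fin \<open>n \<in> S\<close> tL(3) by (intro psubset_card_mono) auto
    ultimately show "min_sum S + 1 \<le> sum x S + card S"
      using min_sum_le[OF tL(1), of S] by simp
  qed
qed

lemma region_subset_stalactite_union:
  defines "r \<equiv> {(a, b). a \<in> {1..p} \<and> b \<in> {1..p} \<and> a \<le> b}"
  shows "region \<subseteq> stalactite_union p r T"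
proof
  fix x
  assume x: "x \<in> region"
  let ?P = "\<lambda>t. t \<in> T \<and> x \<le> t \<and> (\<forall>k. t k \<le> x k + 1)"
  \<comment> \<open>Moving a unit from \<open>l\<close> to \<open>n\<close> changes this weight by
    \<open>n - l\<close>. At a minimum the receiving index is therefore larger, so the first
    difference is at \<open>l\<close> and the moved vector precedes \<open>t\<close>.\<close>
  let ?w = "\<lambda>t. \<Sum>k\<in>{1..p}. k * t k"
  obtain t0 where "?P t0"
    using region_near_top[OF x] by blast
  then obtain t where t: "t \<in> T" "x \<le> t" "\<And>k. t k \<le> x k + 1"
    and least: "\<And>s. ?P s \<Longrightarrow> ?w t \<le> ?w s"
    using ex_has_least_nat[of ?P t0 ?w] by blast
  define L where "L = {k. t k > x k}"
  have L: "L \<subseteq> {1..p}"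
    using t(1) T_vectors unfolding L_def vectors_def by force
  have "x = t - (\<Sum>l\<in>L. unit_vec l)"
  proof
    fix k
    show "x k = (t - (\<Sum>l\<in>L. unit_vec l)) k"
      using le_funD[OF t(2), of k] t(3)[of k] sum_unit_vecs_apply[of L k] finite_subset[OF L]
      by (auto simp: L_def)
  qed
  moreover have "L \<subseteq> stalactite_directions p t {v \<in> T. lex_less p r v t}"
  proof
    fix l
    assume "l \<in> L"
    then have l: "l \<in> {1..p}" "t l > x l"
      using L by (auto simp: L_def)
    obtain n where n: "n \<in> {1..p}" "t n \<le> x n" "move l n t \<in> T"
      using fundamental_set_slack[OF x t(1) l] by blast
    have "n \<noteq> l"
      using n l by auto
    have "n > l"
    proof (rule ccontr)
      assume "\<not> ?thesis"
      then have "n < l"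
        using \<open>n \<noteq> l\<close> by simp
      have "?P (move l n t)"
        using n l t by (auto simp: le_fun_def move_apply le_diff_conv trans_le_add1 le_SucI)
      then have "?w t \<le> ?w (move l n t)"
        by (rule least)
      moreover have "?w (move l n t) + l = ?w t + n"
      proof -
        have "?w (move l n t) + (\<Sum>k\<in>{1..p}. k * unit_vec l k)
            = ?w t + (\<Sum>k\<in>{1..p}. k * unit_vec n k)"
          unfolding sum.distrib[symmetric]
          using l(2) by (intro sum.cong) (auto simp: move_apply unit_vec_def algebra_simps)
        moreover have "(\<Sum>k\<in>{1..p}. k * unit_vec m k) = m" if "m \<in> {1..p}" for m
          using that by (simp add: unit_vec_def if_distrib cong: if_cong)
        ultimately show ?thesis
          using l n by simp
      qed
      ultimately show False
        using \<open>n < l\<close> by simp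
    qed
    have "lex_less p r (move l n t) t"
      unfolding lex_less_def
      using l \<open>n > l\<close> by (intro bexI[of _ l]) (auto simp: r_def move_apply)
    then show "l \<in> stalactite_directions p t {v \<in> T. lex_less p r v t}"
      using l n unfolding stalactite_directions_def move_def by auto
  qed
  ultimately show "x \<in> stalactite_union p r T"
    using t(1) unfolding stalactite_union_def stalactite_def by blast
qed

section \<open>The exchange property with the added coordinate\<close>

lemma generalized_polymatroid_region:
  assumes "finite region"
  shows "generalized_polymatroid p region"
proof -
  let ?M = "Max (coord_sum p ` region)"
  let ?h = "\<lambda>a. a(p + 1 := ?M - coord_sum p a)"
  have vec: "region \<subseteq> vectors p"
  proof
    fix x
    assume "x \<in> region"
    then obtain t where t: "t \<in> T" "x \<le> t"
      unfolding region_def independent_def by blast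
    have "x k = 0" if "k \<notin> {1..p}" for k
    proof -
      have "t k = 0"
        using that t(1) T_vectors unfolding vectors_def by blast
      then show ?thesis
        using le_funD[OF t(2), of k] by simp
    qed
    then show "x \<in> vectors p"
      unfolding vectors_def by blast
  qed
  have le_M: "coord_sum p a \<le> ?M" if "a \<in> region" for a
    using that assms by simp
  have sum_h: "coord_sum (p + 1) (?h a) = ?M" if "a \<in> region" for a
    using le_M[OF that] by (simp add: coord_sum_def)
  have "\<exists>j\<in>{1..p + 1}. ?h u j < ?h v j \<and> ?h u - unit_vec i + unit_vec j \<in> ?h ` region"
    if u: "u \<in> region" and v: "v \<in> region" and i: "i \<in> {1..p + 1}" "?h u i > ?h v i" for u v i
  proof (cases "i = p + 1")
    \<comment> \<open>A larger last entry means a smaller coordinate sum, so lowering it amounts to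
      augmenting \<open>u\<close>.\<close>
    case True
    then have lt: "coord_sum p u < coord_sum p v"
      using i by simp
    then obtain j where j: "j \<in> {1..p}" "u j < v j" "u + unit_vec j \<in> region"
      using region_augment[OF u, of v] v unfolding region_def coord_sum_def by blast
    have "coord_sum p (u + unit_vec j) = coord_sum p u + 1"
      using j(1) by (simp add: coord_sum_def plus_fun_def sum.distrib sum_unit_vec)
    then have "?h u - unit_vec i + unit_vec j = ?h (u + unit_vec j)"
      using True j(1) by (auto simp: fun_eq_iff unit_vec_def)
    then show ?thesis
      using j by (intro bexI[of _ j]) auto
  next
    case False
    then have ip: "i \<in> {1..p}" "u i > v i"
      using i by auto
    from region_exchange[OF u v ip] show ?thesis
    proof (elim disjE bexE conjE)
      fix j
      assume j: "j \<in> {1..p}" "u j < v j" "move i j u \<in> region"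
      have "coord_sum p (move i j u) = coord_sum p u"
        using sum_move[of "{1..p}" u i j] ip j(1) by (simp add: coord_sum_def)
      then have "?h u - unit_vec i + unit_vec j = ?h (move i j u)"
        using ip(1) j(1) by (auto simp: fun_eq_iff move_apply unit_vec_def)
      then show ?thesis
        using j by (intro bexI[of _ j]) auto
    next
      assume *: "sum u {1..p} > sum v {1..p}" "u - unit_vec i \<in> region"
      have "coord_sum p (u - unit_vec i) + 1 = coord_sum p u"
        using sum_diff_unit_vec[of "{1..p}" u i] ip by (simp add: coord_sum_def)
      then have "?h u - unit_vec i + unit_vec (p + 1) = ?h (u - unit_vec i)"
        using ip(1) le_M[OF u] vec u by (auto simp: fun_eq_iff unit_vec_def)
      moreover have "?h u (p + 1) < ?h v (p + 1)"
        using *(1) le_M[OF u] by (simp add: coord_sum_def)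
      ultimately show ?thesis
        using *(2) by (intro bexI[of _ "p + 1"]) auto
    qed
  qed
  moreover have "?h ` region \<subseteq> vectors (p + 1)"
    using vec by (auto simp: vectors_def)
  ultimately have "polymatroid (p + 1) (?h ` region)"
    unfolding polymatroid_def using assms sum_h by (auto simp del: fun_upd_apply)
  then show ?thesis
    unfolding generalized_polymatroid_def Let_def Setcompr_eq_image using assms vec by blast
qed

end

theorem theorem5p18:
  fixes p :: nat and C :: "(nat \<Rightarrow> nat) set"
  assumes "cave p C"
  shows "generalized_polymatroid p C"
proof (cases "C = {}")
  case True
  then show ?thesis
    by (simp add: generalized_polymatroid_def polymatroid_def)
next
  case False
  have fin: "finite C"
    using assms by (simp add: cave_def)
  let ?T = "top_part p C"
  \<comment> \<open>Truncating at \<open>0\<close> gives \<open>C\<close> back, hence the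
    polymatroid top and the stalactite formula for every order.\<close>
  have "0 \<in> vectors p" "truncation C 0 = C"
    by (auto simp: vectors_def truncation_def le_fun_def)
  then have poly: "polymatroid p ?T"
    and eq: "\<And>r. linear_order_on {1..p} r \<Longrightarrow> C = stalactite_union p r ?T"
    using assms False unfolding cave_def Let_def by metis+
  have "?T \<noteq> {}"
    using Max_in[of "coord_sum p ` C"] fin False unfolding top_part_def by fastforce
  then interpret nonempty_polymatroid p ?T
    using poly by unfold_locales
  let ?r = "{(a, b). a \<in> {1..p} \<and> b \<in> {1..p} \<and> a \<le> b}"
  have "linear_order_on {1..p} ?r"
    unfolding linear_order_on_def partial_order_on_def preorder_on_def
      refl_on_def trans_def antisym_def total_on_def by auto
  then have "region = C"
    using eq stalactite_union_subset_region region_subset_stalactite_union by blast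
  then show ?thesis
    using generalized_polymatroid_region fin by simp
qed

end
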